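(* Let $p\in(\frac12,1]$, $\alpha,\beta>0$ and $\gamma,\delta\ge0$, and suppose that $a=b=1$, where $$a=\frac{1}{2\alpha}\Big(2p-1-\alpha+\gamma+\sqrt{(2p-1-\alpha+\gamma)^2+4\alpha\gamma}\Big),\qquad b=\frac{1}{2\beta}\Big(2p-1-\beta+\delta+\sqrt{(2p-1-\beta+\delta)^2+4\beta\delta}\Big)$$ (equivalently $\alpha-\gamma=\beta-\delta=p-\frac12$). Then there is a constant $C=C(\alpha,\beta,\gamma,\delta,p)$ such that for all $\varepsilon\in(0,1)$ the $\varepsilon$-mixing time of the simple exclusion process with open boundaries with parameters $(p,\alpha,\beta,\gamma,\delta)$ satisfies $$t^N_{\mathrm{mix}}(\varepsilon)\le C N^3$$ for all $N$ sufficiently large (depending on $\varepsilon$).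
   Context: For $N\in\mathbb{N}$ let $[N]=\{1,\dots,N\}$ and $\Omega_N=\{0,1\}^N$; site $x$ is occupied by a particle in $\eta\in\Omega_N$ if $\eta(x)=1$ and empty if $\eta(x)=0$. The simple exclusion process with open boundaries with parameters $(p,\alpha,\beta,\gamma,\delta)$, $p\in[0,1]$, $\alpha,\beta,\gamma,\delta\ge0$, is the continuous-time Markov chain $(\eta_t)_{t\ge0}$ on $\Omega_N$ with generator $$\mathcal{L}f(\eta)=\sum_{x=1}^{N-1}p\,\eta(x)(1-\eta(x+1))[f(\eta^{x,x+1})-f(\eta)]+\sum_{x=2}^{N}(1-p)\,\eta(x)(1-\eta(x-1))[f(\eta^{x,x-1})-f(\eta)]$$ $$\qquad+\big(\alpha(1-\eta(1))+\gamma\eta(1)\big)[f(\eta^1)-f(\eta)]+\big(\delta(1-\eta(N))+\beta\eta(N)\big)[f(\eta^N)-f(\eta)],$$ where $\eta^{x,y}$ is $\eta$ with the values at $x,y$ exchanged and $\eta^x$ is $\eta$ with the value at $x$ flipped. The parameters do not depend on $N$. Parameters are such that there is a unique stationary distribution $\mu$ (depending on $N$). The $\varepsilon$-mixing time is $$t^N_{\mathrm{mix}}(\varepsilon)=\inf\Big\{t\ge0:\max_{\eta\in\Omega_N}\|\mathbb{P}(\eta_t\in\cdot\mid\eta_0=\eta)-\mu\|_{\mathrm{TV}}<\varepsilon\Big\},\qquad \|\mu-\nu\|_{\mathrm{TV}}=\tfrac12\sum_{x\in\Omega_N}|\mu(x)-\nu(x)|.$$ *)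

theory Defs
  imports "HOL-Probability.Probability"
begin

text \<open>A chain on a finite set \<open>S\<close> is given by its generator \<open>L\<close>, acting on functions;
  only the values of \<open>L f\<close> on \<open>S\<close> matter, and there they must depend only on the values
  of \<open>f\<close> on \<open>S\<close>.\<close>

text \<open>The semigroup \<open>exp (t L)\<close>, which sends \<open>f\<close> to the map
  \<open>x \<mapsto> E[f(X\<^sub>t) | X\<^sub>0 = x]\<close>.\<close>

definition ctmc_semigroup :: "(('s \<Rightarrow> real) \<Rightarrow> 's \<Rightarrow> real) \<Rightarrow> real \<Rightarrow> ('s \<Rightarrow> real) \<Rightarrow> 's \<Rightarrow> real" where
  "ctmc_semigroup L t f x = (\<Sum>n. t ^ n / fact n * (L ^^ n) f x)"

text \<open>\<open>transition_prob L t x y\<close> is \<open>P(X\<^sub>t = y | X\<^sub>0 = x)\<close>.\<close>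

definition transition_prob :: "(('s \<Rightarrow> real) \<Rightarrow> 's \<Rightarrow> real) \<Rightarrow> real \<Rightarrow> 's \<Rightarrow> 's \<Rightarrow> real" where
  "transition_prob L t x y = ctmc_semigroup L t (indicat_real {y}) x"

definition stationary :: "'s set \<Rightarrow> (('s \<Rightarrow> real) \<Rightarrow> 's \<Rightarrow> real) \<Rightarrow> 's pmf \<Rightarrow> bool" where
  "stationary S L \<mu> \<longleftrightarrow> set_pmf \<mu> \<subseteq> S \<and>
     (\<forall>t\<ge>0. \<forall>y\<in>S. (\<Sum>x\<in>S. pmf \<mu> x * transition_prob L t x y) = pmf \<mu> y)"

definition stationary_distribution :: "'s set \<Rightarrow> (('s \<Rightarrow> real) \<Rightarrow> 's \<Rightarrow> real) \<Rightarrow> 's pmf" where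
  "stationary_distribution S L = (THE \<mu>. stationary S L \<mu>)"

definition tv_dist :: "'s set \<Rightarrow> ('s \<Rightarrow> real) \<Rightarrow> ('s \<Rightarrow> real) \<Rightarrow> real" where
  "tv_dist S \<mu> \<nu> = 1 / 2 * (\<Sum>x\<in>S. \<bar>\<mu> x - \<nu> x\<bar>)"

text \<open>Extended-real valued, so that the infimum of the empty set is \<open>\<infinity>\<close>.\<close>

definition mixing_time :: "'s set \<Rightarrow> (('s \<Rightarrow> real) \<Rightarrow> 's \<Rightarrow> real) \<Rightarrow> real \<Rightarrow> ereal" where
  "mixing_time S L \<epsilon> =
     (INF t\<in>{t. 0 \<le> t \<and>
        Max ((\<lambda>x. tv_dist S (transition_prob L t x) (pmf (stationary_distribution S L))) ` S) < \<epsilon>}.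
      ereal t)"

type_synonym config = "nat \<Rightarrow> nat"

definition configs :: "nat \<Rightarrow> config set" where
  "configs N = {1..N} \<rightarrow>\<^sub>E {0, 1}"

definition exchange :: "config \<Rightarrow> nat \<Rightarrow> nat \<Rightarrow> config" where
  "exchange \<eta> x y = \<eta>(x := \<eta> y, y := \<eta> x)"

definition flip :: "config \<Rightarrow> nat \<Rightarrow> config" where
  "flip \<eta> x = \<eta>(x := 1 - \<eta> x)"

definition sep_generator ::
  "real \<Rightarrow> real \<Rightarrow> real \<Rightarrow> real \<Rightarrow> real \<Rightarrow> nat \<Rightarrow> (config \<Rightarrow> real) \<Rightarrow> config \<Rightarrow> real" where
  "sep_generator p \<alpha> \<beta> \<gamma> \<delta> N f \<eta> =
     (\<Sum>x = 1..N - 1. p * real (\<eta> x) * (1 - real (\<eta> (x + 1))) * (f (exchange \<eta> x (x + 1)) - f \<eta>))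
   + (\<Sum>x = 2..N. (1 - p) * real (\<eta> x) * (1 - real (\<eta> (x - 1))) * (f (exchange \<eta> x (x - 1)) - f \<eta>))
   + (\<alpha> * (1 - real (\<eta> 1)) + \<gamma> * real (\<eta> 1)) * (f (flip \<eta> 1) - f \<eta>)
   + (\<delta> * (1 - real (\<eta> N)) + \<beta> * real (\<eta> N)) * (f (flip \<eta> N) - f \<eta>)"

definition sep_mixing_time ::
  "real \<Rightarrow> real \<Rightarrow> real \<Rightarrow> real \<Rightarrow> real \<Rightarrow> nat \<Rightarrow> real \<Rightarrow> ereal" where
  "sep_mixing_time p \<alpha> \<beta> \<gamma> \<delta> N \<epsilon> = mixing_time (configs N) (sep_generator p \<alpha> \<beta> \<gamma> \<delta> N) \<epsilon>"

end

theory Submission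
  imports Defs
begin

text \<open>The condition \<open>a = b = 1\<close> says that both reservoirs try to impose density one half, which means
  \<open>\<alpha> - \<gamma> = \<beta> - \<delta> = p - 1/2\<close>. At this density the drift through the bulk and the net input at
  the two ends balance, and the uniform measure on \<open>{0,1}\<^sup>N\<close> is stationary although the process is
  not reversible (\<open>sum_sep_generator\<close>).

  Since the stationary measure is uniform, mixing can be controlled in \<open>L\<^sup>2\<close>. The decay rate of
  \<open>\<Sum>(P\<^sub>t f)\<^sup>2\<close> only involves the quadratic form \<open>- \<Sum> f L f\<close>, and this form does not see the
  asymmetry: averaging a rate with that of the reverse move gives a symmetric exclusion process,
  whose bonds swap at rate \<open>1/2\<close> and whose end sites flip at rates \<open>(\<alpha> + \<gamma>)/2\<close> and
  \<open>(\<beta> + \<delta>)/2\<close> (\<open>sep_dissipation\<close>).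

  A spectral gap of order \<open>N\<^sup>-\<^sup>2\<close> for that form comes from comparison with the hypercube, on
  which every site may flip (\<open>hypercube_poincare\<close>). To flip site \<open>x\<close>, carry its value to site \<open>1\<close>
  by \<open>x - 1\<close> swaps, flip there, and carry it back. With Cauchy--Schwarz along this path of length
  \<open>O(x)\<close>, one flip costs \<open>O(x)\<close> times the total swap and boundary energy (\<open>flip_energy_le\<close>), and
  summing over \<open>x\<close> produces the factor \<open>N\<^sup>2\<close> (\<open>bond_flip_poincare\<close>).

  The gap \<open>c/N\<^sup>2\<close> bounds the total variation distance at time \<open>t\<close> by
  \<open>1/2 exp (- c t / N\<^sup>2) 2\<^sup>N\<^sup>/\<^sup>2\<close>, where \<open>2\<^sup>N\<^sup>/\<^sup>2\<close> is the price of a start from a single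
  configuration (\<open>tv_dist_uniform_le\<close>). At \<open>t = N\<^sup>3/c\<close> the bound is \<open>1/2 (\<surd>2/e)\<^sup>N\<close>, which tends
  to \<open>0\<close>. Hence \<open>C = 1/c\<close> serves every \<open>\<epsilon>\<close>, and only the threshold for \<open>N\<close> depends on \<open>\<epsilon>\<close>.\<close>

section \<open>Semigroups of generators on a finite set\<close>

text \<open>The congruence rule says that on \<open>S\<close> the operator only looks at values on \<open>S\<close>, so that there
  \<open>L\<close> acts as a finite matrix, even though \<open>f\<close> may be arbitrary elsewhere. The last condition
  is conservation of probability.\<close>

locale finite_generator =
  fixes S :: "'s set" and L :: "('s \<Rightarrow> real) \<Rightarrow> 's \<Rightarrow> real"
  assumes finite_S: "finite S"
    and nonempty_S: "S \<noteq> {}"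
    and L_cong: "\<And>f g x. (\<And>y. y \<in> S \<Longrightarrow> f y = g y) \<Longrightarrow> x \<in> S \<Longrightarrow> L f x = L g x"
    and L_add: "\<And>f g x. L (\<lambda>y. f y + g y) x = L f x + L g x"
    and L_scale: "\<And>c f x. L (\<lambda>y. c * f y) x = c * L f x"
    and L_const: "\<And>c x. L (\<lambda>_. c) x = 0"
begin

abbreviation P :: "real \<Rightarrow> ('s \<Rightarrow> real) \<Rightarrow> 's \<Rightarrow> real" where
  "P \<equiv> ctmc_semigroup L"

lemma L_sum: "finite A \<Longrightarrow> L (\<lambda>y. \<Sum>i\<in>A. c i * f i y) x = (\<Sum>i\<in>A. c i * L (f i) x)"
  by (induction A rule: finite_induct) (simp_all add: L_const L_add L_scale)

lemma expand_on_S: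
  assumes "y \<in> S"
  shows "f y = (\<Sum>z\<in>S. f z * indicat_real {z} y)"
  using assms finite_S by (simp add: indicator_def if_distrib sum.delta' cong: if_cong)

lemma L_matrix:
  assumes "x \<in> S"
  shows "L f x = (\<Sum>z\<in>S. f z * L (indicat_real {z}) x)"
proof -
  have "L f x = L (\<lambda>y. \<Sum>z\<in>S. f z * indicat_real {z} y) x"
    by (rule L_cong[OF expand_on_S assms])
  then show ?thesis
    by (simp add: L_sum[OF finite_S])
qed

text \<open>A crude bound on the operator norm for the maximum norm on \<open>S\<close>, from which the exponential
  series converges.\<close>

definition op_bound :: real where
  "op_bound = (\<Sum>x\<in>S. \<Sum>z\<in>S. \<bar>L (indicat_real {z}) x\<bar>)"

lemma L_bound:
  assumes "\<And>y. y \<in> S \<Longrightarrow> \<bar>f y\<bar> \<le> M" and x: "x \<in> S"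
  shows "\<bar>L f x\<bar> \<le> op_bound * M"
proof -
  have M: "0 \<le> M"
    using assms(1)[OF x] by linarith
  have "\<bar>L f x\<bar> \<le> (\<Sum>z\<in>S. \<bar>f z * L (indicat_real {z}) x\<bar>)"
    unfolding L_matrix[OF x, of f] by (rule sum_abs)
  also have "\<dots> \<le> (\<Sum>z\<in>S. M * \<bar>L (indicat_real {z}) x\<bar>)"
    using assms by (intro sum_mono) (auto simp: abs_mult intro!: mult_right_mono)
  also have "\<dots> = (\<Sum>z\<in>S. \<bar>L (indicat_real {z}) x\<bar>) * M"
    by (simp add: sum_distrib_left mult.commute)
  also have "\<dots> \<le> op_bound * M"
    unfolding op_bound_def using M finite_S x
    by (intro mult_right_mono
          member_le_sum[where f = "\<lambda>x. \<Sum>z\<in>S. \<bar>L (indicat_real {z}) x\<bar>"] sum_nonneg) auto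
  finally show ?thesis .
qed

lemma L_funpow_bound:
  assumes "\<And>y. y \<in> S \<Longrightarrow> \<bar>f y\<bar> \<le> M" and "x \<in> S"
  shows "\<bar>(L ^^ n) f x\<bar> \<le> op_bound ^ n * M"
  using assms(2)
proof (induction n arbitrary: x)
  case (Suc n)
  then show ?case
    using L_bound[of "(L ^^ n) f" "op_bound ^ n * M" x] by (simp add: mult.assoc)
qed (use assms in simp)

lemma finite_bounded: "\<exists>M. \<forall>y\<in>S. \<bar>f y\<bar> \<le> (M::real)"
  using finite_S by (intro exI[of _ "\<Sum>y\<in>S. \<bar>f y\<bar>"] ballI member_le_sum[where f = "\<lambda>y. \<bar>f y\<bar>"]) auto

lemma semigroup_summable:
  assumes "x \<in> S"
  shows "summable (\<lambda>n. (L ^^ n) f x / fact n * t ^ n)"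
proof -
  obtain M where M: "\<And>y. y \<in> S \<Longrightarrow> \<bar>f y\<bar> \<le> M"
    using finite_bounded[of f] by blast
  have "norm ((L ^^ n) f x / fact n * t ^ n) \<le> M * ((op_bound * \<bar>t\<bar>) ^ n /\<^sub>R fact n)" for n
  proof -
    have "norm ((L ^^ n) f x / fact n * t ^ n) = \<bar>(L ^^ n) f x\<bar> * (\<bar>t\<bar> ^ n / fact n)"
      by (simp add: abs_mult power_abs)
    also have "\<dots> \<le> (op_bound ^ n * M) * (\<bar>t\<bar> ^ n / fact n)"
      using L_funpow_bound[OF M assms, where n = n] by (intro mult_right_mono) auto
    finally show ?thesis
      by (simp add: power_mult_distrib field_simps)
  qed
  then show ?thesis
    by (intro summable_comparison_test'[OF summable_mult[OF summable_exp_generic]])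
qed

lemma semigroup_sums:
  assumes "x \<in> S"
  shows "(\<lambda>n. (L ^^ n) f x / fact n * t ^ n) sums P t f x"
  using summable_sums[OF semigroup_summable[OF assms, of f t]]
  by (simp add: ctmc_semigroup_def mult.commute)

lemma semigroup_0: "P 0 f x = f x"
proof -
  have "P 0 f x = (\<Sum>n\<in>{0}. 0 ^ n / fact n * (L ^^ n) f x)"
    unfolding ctmc_semigroup_def by (rule suminf_finite) auto
  then show ?thesis by simp
qed

lemma semigroup_linear_comb:
  assumes "finite A" and x: "x \<in> S"
  shows "P t (\<lambda>y. \<Sum>i\<in>A. c i * f i y) x = (\<Sum>i\<in>A. c i * P t (f i) x)"
proof -
  have pow: "(L ^^ n) (\<lambda>y. \<Sum>i\<in>A. c i * f i y) = (\<lambda>y. \<Sum>i\<in>A. c i * (L ^^ n) (f i) y)" for n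
    by (induction n) (auto intro!: ext simp: L_sum[OF assms(1)])
  have "(\<lambda>n. \<Sum>i\<in>A. c i * ((L ^^ n) (f i) x / fact n * t ^ n)) sums (\<Sum>i\<in>A. c i * P t (f i) x)"
    by (intro sums_sum sums_mult semigroup_sums x)
  moreover have "(\<lambda>n. \<Sum>i\<in>A. c i * ((L ^^ n) (f i) x / fact n * t ^ n)) sums
      P t (\<lambda>y. \<Sum>i\<in>A. c i * f i y) x"
    using semigroup_sums[OF x, of "\<lambda>y. \<Sum>i\<in>A. c i * f i y" t]
    by (simp add: pow sum_divide_distrib sum_distrib_right mult.assoc)
  ultimately show ?thesis
    by (rule sums_unique2[symmetric])
qed

lemma semigroup_cong:
  assumes "\<And>y. y \<in> S \<Longrightarrow> f y = g y" and x: "x \<in> S"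
  shows "P t f x = P t g x"
proof -
  have "\<forall>x\<in>S. (L ^^ n) f x = (L ^^ n) g x" for n
    by (induction n) (auto simp: assms intro!: L_cong)
  then show ?thesis
    using x by (simp add: ctmc_semigroup_def)
qed

lemma semigroup_const: "P t (\<lambda>_. c) x = c"
proof -
  have "(L ^^ n) (\<lambda>_. c) x = (if n = 0 then c else 0)" for n
    by (induction n arbitrary: x) (auto simp: L_const fun_eq_iff[symmetric], metis L_const ext)
  then have "P t (\<lambda>_. c) x = (\<Sum>n\<in>{0}. t ^ n / fact n * (L ^^ n) (\<lambda>_. c) x)"
    unfolding ctmc_semigroup_def by (intro suminf_finite) auto
  then show ?thesis by simp
qed

lemma semigroup_commute:
  assumes x: "x \<in> S"
  shows "L (P t f) x = P t (L f) x"
proof -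
  have "(\<lambda>n. \<Sum>z\<in>S. L (indicat_real {z}) x * ((L ^^ n) f z / fact n * t ^ n)) sums
      (\<Sum>z\<in>S. L (indicat_real {z}) x * P t f z)"
    by (intro sums_sum sums_mult semigroup_sums)
  moreover have "(\<Sum>z\<in>S. L (indicat_real {z}) x * ((L ^^ n) f z / fact n * t ^ n)) =
      (L ^^ n) (L f) x / fact n * t ^ n" for n
    using L_matrix[OF x, of "(L ^^ n) f"]
    by (simp add: funpow_swap1 sum_distrib_left sum_distrib_right sum_divide_distrib mult_ac)
  ultimately have "(\<Sum>z\<in>S. L (indicat_real {z}) x * P t f z) = P t (L f) x"
    using semigroup_sums[OF x, of "L f" t] by (simp add: sums_unique2)
  then show ?thesis
    by (simp add: L_matrix[OF x, of "P t f"] mult.commute)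
qed

text \<open>Differentiating the power series in \<open>t\<close> term by term shifts it by one application of \<open>L\<close> to
  \<open>f\<close>; by \<open>semigroup_commute\<close> that \<open>L\<close> may be moved to the outside.\<close>

lemma semigroup_deriv:
  assumes x: "x \<in> S"
  shows "((\<lambda>t. P t f x) has_real_derivative L (P t f) x) (at t)"
proof -
  define c where "c n = (L ^^ n) f x / fact n" for n
  have P_c: "(\<Sum>n. c n * s ^ n) = P s f x" for s
    using sums_unique[OF semigroup_sums[OF x, of f s]] by (simp add: c_def)
  have diffs_c: "diffs c n = (L ^^ n) (L f) x / fact n" for n
    by (simp add: c_def diffs_def funpow_swap1 del: of_nat_Suc)
  have "((\<lambda>s. \<Sum>n. c n * s ^ n) has_real_derivative (\<Sum>n. diffs c n * t ^ n)) (at t)"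
    unfolding c_def by (intro termdiffs_strong_converges_everywhere semigroup_summable x)
  moreover have "(\<Sum>n. diffs c n * t ^ n) = P t (L f) x"
    using sums_unique[OF semigroup_sums[OF x, of "L f" t]] by (simp add: diffs_c)
  ultimately show ?thesis
    by (simp add: P_c semigroup_commute[OF x])
qed

end

section \<open>Decay to the uniform measure\<close>

text \<open>The vanishing of \<open>\<Sum> L f\<close> is invariance of the uniform measure. The second condition is a
  spectral gap for the symmetric part of \<open>L\<close> in \<open>L\<^sup>2\<close> of the uniform measure, which is how a gap
  is measured for a generator that need not be reversible.\<close>

locale uniform_gap = finite_generator +
  fixes gap :: real
  assumes sum_L: "\<And>f. (\<Sum>x\<in>S. L f x) = 0"
    and dissipation: "\<And>f. (\<Sum>x\<in>S. f x) = 0 \<Longrightarrow>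
      gap * (\<Sum>x\<in>S. (f x)\<^sup>2) \<le> - (\<Sum>x\<in>S. f x * L f x)"
begin

lemma sum_semigroup: "(\<Sum>x\<in>S. P t f x) = (\<Sum>x\<in>S. f x)"
proof -
  have "((\<lambda>t. \<Sum>x\<in>S. P t f x) has_real_derivative (\<Sum>x\<in>S. L (P t f) x)) (at t)" for t
    by (intro DERIV_sum semigroup_deriv)
  then have "((\<lambda>t. \<Sum>x\<in>S. P t f x) has_real_derivative 0) (at t)" for t
    by (simp add: sum_L)
  then have "(\<Sum>x\<in>S. P t f x) = (\<Sum>x\<in>S. P 0 f x)"
    using DERIV_isconst_all by blast
  then show ?thesis
    by (simp add: semigroup_0)
qed

lemma stationary_uniform: "stationary S L (pmf_of_set S)"
proof -
  have "(\<Sum>x\<in>S. pmf (pmf_of_set S) x * transition_prob L t x y) = pmf (pmf_of_set S) y"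
    if "y \<in> S" for t y
  proof -
    have "(\<Sum>x\<in>S. transition_prob L t x y) = 1"
      unfolding transition_prob_def sum_semigroup using that finite_S
      by (simp add: indicator_def)
    then show ?thesis
      using that finite_S nonempty_S
      by (simp add: pmf_of_set indicator_def sum_divide_distrib[symmetric])
  qed
  then show ?thesis
    using finite_S nonempty_S by (simp add: stationary_def)
qed

text \<open>Gronwall: \<open>exp (2 gap t) \<Sum>(P\<^sub>t f)\<^sup>2\<close> is nonincreasing, because the derivative of
  \<open>\<Sum>(P\<^sub>t f)\<^sup>2\<close> is \<open>2 \<Sum> P\<^sub>t f L(P\<^sub>t f)\<close> and \<open>P\<^sub>t f\<close> keeps mean zero.\<close>

lemma square_norm_decay:
  assumes mean: "(\<Sum>x\<in>S. f x) = 0" and "0 \<le> t"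
  shows "(\<Sum>x\<in>S. (P t f x)\<^sup>2) \<le> exp (- 2 * gap * t) * (\<Sum>x\<in>S. (f x)\<^sup>2)"
proof -
  define \<phi> where "\<phi> s = exp (2 * gap * s) * (\<Sum>x\<in>S. (P s f x)\<^sup>2)" for s
  have "\<phi> t \<le> \<phi> 0"
  proof (rule DERIV_nonpos_imp_nonincreasing[OF assms(2)])
    fix s
    have "((\<lambda>s. \<Sum>x\<in>S. (P s f x)\<^sup>2) has_real_derivative (\<Sum>x\<in>S. 2 * (P s f x * L (P s f) x))) (at s)"
      by (intro DERIV_sum) (auto intro!: derivative_eq_intros semigroup_deriv)
    moreover have "((\<lambda>s. exp (2 * gap * s)) has_real_derivative exp (2 * gap * s) * (2 * gap)) (at s)"
      by (auto intro!: derivative_eq_intros)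
    ultimately have "(\<phi> has_real_derivative
        exp (2 * gap * s) * (2 * (gap * (\<Sum>x\<in>S. (P s f x)\<^sup>2) + (\<Sum>x\<in>S. P s f x * L (P s f) x)))) (at s)"
      unfolding \<phi>_def
      by (intro DERIV_cong[OF DERIV_mult]) (auto simp: sum_distrib_left[symmetric] algebra_simps)
    moreover have "gap * (\<Sum>x\<in>S. (P s f x)\<^sup>2) + (\<Sum>x\<in>S. P s f x * L (P s f) x) \<le> 0"
      using dissipation[of "P s f"] mean by (simp add: sum_semigroup)
    ultimately show "\<exists>y. (\<phi> has_real_derivative y) (at s) \<and> y \<le> 0"
      by (meson exp_ge_zero mult_nonneg_nonpos zero_le_numeral)
  qed
  then have "exp (2 * gap * t) * (\<Sum>x\<in>S. (P t f x)\<^sup>2) \<le> (\<Sum>x\<in>S. (f x)\<^sup>2)"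
    by (simp add: \<phi>_def semigroup_0)
  then have "exp (- 2 * gap * t) * (exp (2 * gap * t) * (\<Sum>x\<in>S. (P t f x)\<^sup>2)) \<le>
      exp (- 2 * gap * t) * (\<Sum>x\<in>S. (f x)\<^sup>2)"
    by (intro mult_left_mono) auto
  then show ?thesis
    by (simp add: mult.assoc[symmetric] exp_add[symmetric])
qed

text \<open>Duality turns the distance between measures into a statement about functions. With \<open>s\<close> the sign
  of \<open>p\<^sub>t(x, \<cdot>) - \<pi>\<close>, where \<open>\<pi>\<close> is the uniform measure, twice the distance is
  \<open>P\<^sub>t (s - \<pi>(s)) (x)\<close>. The centred function has sum of squares at most \<open>card S\<close>,
  which decays under \<open>P\<^sub>t\<close>, and the value at \<open>x\<close> is at most the square root of that sum. Testing
  against \<open>s\<close> lets the decay of \<open>P\<^sub>t\<close> on functions replace that of its adjoint on densities.\<close>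

lemma tv_dist_uniform_le:
  assumes x: "x \<in> S" and t: "0 \<le> t"
  shows "tv_dist S (transition_prob L t x) (pmf (pmf_of_set S)) \<le>
    1 / 2 * (exp (- gap * t) * sqrt (card S))"
proof -
  define n where "n = real (card S)"
  have n: "0 < n"
    using finite_S nonempty_S by (simp add: n_def card_gt_0_iff)
  define s where "s y = sgn (transition_prob L t x y - 1 / n)" for y
  define m where "m = (\<Sum>y\<in>S. s y) / n"
  define g where "g y = s y - m" for y
  have sum_s: "(\<Sum>y\<in>S. s y) = n * m"
    using n by (simp add: m_def)
  have sum_g: "(\<Sum>y\<in>S. g y) = 0"
    by (simp add: g_def sum_subtractf sum_s n_def)
  have sum_g2: "(\<Sum>y\<in>S. (g y)\<^sup>2) \<le> n"
  proof -
    have "(\<Sum>y\<in>S. (g y)\<^sup>2) = (\<Sum>y\<in>S. (s y)\<^sup>2 - 2 * m * s y + m\<^sup>2)"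
      by (simp add: g_def power2_eq_square algebra_simps)
    also have "\<dots> = (\<Sum>y\<in>S. (s y)\<^sup>2) - 2 * m * (\<Sum>y\<in>S. s y) + n * m\<^sup>2"
      by (simp add: sum.distrib sum_subtractf sum_distrib_left n_def)
    also have "\<dots> = (\<Sum>y\<in>S. (s y)\<^sup>2) - n * m\<^sup>2"
      by (simp add: sum_s power2_eq_square)
    also have "\<dots> \<le> (\<Sum>y\<in>S. (s y)\<^sup>2)"
      using n by simp
    also have "\<dots> \<le> (\<Sum>y\<in>S. 1)"
      by (intro sum_mono) (auto simp: s_def sgn_if)
    finally show ?thesis by (simp add: n_def)
  qed
  have "(\<Sum>y\<in>S. \<bar>transition_prob L t x y - pmf (pmf_of_set S) y\<bar>) =
      (\<Sum>y\<in>S. s y * (transition_prob L t x y - 1 / n))"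
    using finite_S nonempty_S
    by (intro sum.cong) (auto simp: s_def n_def pmf_of_set abs_sgn mult.commute)
  also have "\<dots> = (\<Sum>y\<in>S. s y * P t (indicat_real {y}) x) - m"
    by (simp add: algebra_simps sum_subtractf transition_prob_def m_def sum_divide_distrib)
  also have "(\<Sum>y\<in>S. s y * P t (indicat_real {y}) x) = P t s x"
    unfolding semigroup_linear_comb[OF finite_S x, symmetric]
    by (rule semigroup_cong[OF expand_on_S[symmetric] x])
  also have "P t s x - m = P t g x"
  proof -
    \<comment> \<open>A two-term linear combination, indexed by the booleans, of \<open>s\<close> and the constant \<open>1\<close>.\<close>
    have "P t g x = P t (\<lambda>y. \<Sum>i\<in>{True, False}. (if i then 1 else - m) * (if i then s y else 1)) x"
      by (intro semigroup_cong[OF _ x]) (simp add: g_def)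
    also have "\<dots> = P t s x - m"
      by (subst semigroup_linear_comb[OF _ x]) (simp_all add: semigroup_const)
    finally show ?thesis ..
  qed
  also have "P t g x \<le> sqrt ((P t g x)\<^sup>2)"
    by simp
  also have "\<dots> \<le> sqrt (\<Sum>y\<in>S. (P t g y)\<^sup>2)"
    using finite_S x
    by (intro real_sqrt_le_mono member_le_sum[where f = "\<lambda>y. (P t g y)\<^sup>2"]) auto
  also have "\<dots> \<le> sqrt (exp (- 2 * gap * t) * n)"
    using square_norm_decay[OF sum_g t] sum_g2
    by (intro real_sqrt_le_mono) (meson exp_ge_zero mult_left_mono order_trans)
  also have "\<dots> = sqrt ((exp (- gap * t))\<^sup>2 * n)"
    by (simp add: power2_eq_square exp_add[symmetric])
  also have "\<dots> = exp (- gap * t) * sqrt n"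
    by (simp add: real_sqrt_mult)
  finally show ?thesis
    by (simp add: tv_dist_def n_def)
qed

lemma mixing_time_le:
  assumes unique: "\<exists>!\<mu>. stationary S L \<mu>" and t: "0 \<le> t"
    and "1 / 2 * (exp (- gap * t) * sqrt (card S)) < \<epsilon>"
  shows "mixing_time S L \<epsilon> \<le> ereal t"
proof -
  have "stationary_distribution S L = pmf_of_set S"
    unfolding stationary_distribution_def
    using the1_equality[OF unique stationary_uniform] .
  moreover have "tv_dist S (transition_prob L t x) (pmf (pmf_of_set S)) < \<epsilon>" if "x \<in> S" for x
    using tv_dist_uniform_le[OF that t] assms(3) by (rule le_less_trans)
  ultimately have "Max ((\<lambda>x. tv_dist S (transition_prob L t x) (pmf (stationary_distribution S L))) ` S) < \<epsilon>"
    using finite_S nonempty_S by (subst Max_less_iff) auto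
  then show ?thesis
    unfolding mixing_time_def using t by (intro INF_lower) auto
qed

end

section \<open>Configurations under exchanges and flips\<close>

lemma finite_configs: "finite (configs N)"
  by (simp add: configs_def finite_PiE)

lemma card_configs: "card (configs N) = 2 ^ N"
  by (simp add: configs_def card_PiE numeral_2_eq_2)

lemma configs_nonempty: "configs N \<noteq> {}"
  by (simp add: configs_def PiE_eq_empty_iff)

lemma configs_value: "\<eta> \<in> configs N \<Longrightarrow> x \<in> {1..N} \<Longrightarrow> \<eta> x = 0 \<or> \<eta> x = 1"
  unfolding configs_def by (drule PiE_mem) auto

lemma exchange_configs:
  "\<eta> \<in> configs N \<Longrightarrow> x \<in> {1..N} \<Longrightarrow> y \<in> {1..N} \<Longrightarrow> exchange \<eta> x y \<in> configs N"
  by (auto simp: configs_def exchange_def PiE_iff extensional_def)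

lemma flip_configs: "\<eta> \<in> configs N \<Longrightarrow> x \<in> {1..N} \<Longrightarrow> flip \<eta> x \<in> configs N"
  by (auto simp: configs_def flip_def PiE_iff extensional_def)

lemma exchange_exchange [simp]: "exchange (exchange \<eta> x y) x y = \<eta>"
  by (auto simp: exchange_def)

lemma exchange_commute: "exchange \<eta> x y = exchange \<eta> y x"
  by (auto simp: exchange_def)

lemma exchange_trivial: "\<eta> x = \<eta> y \<Longrightarrow> exchange \<eta> x y = \<eta>"
  by (auto simp: exchange_def)

lemma flip_flip: "\<eta> \<in> configs N \<Longrightarrow> x \<in> {1..N} \<Longrightarrow> flip (flip \<eta> x) x = \<eta>"
  using configs_value[of \<eta> N x] by (auto simp: flip_def)

lemma sum_exchange:
  assumes "x \<in> {1..N}" "y \<in> {1..N}"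
  shows "(\<Sum>\<eta>\<in>configs N. F (exchange \<eta> x y)) = (\<Sum>\<eta>\<in>configs N. F \<eta>)"
  by (rule sum.reindex_bij_witness[of _ "\<lambda>\<eta>. exchange \<eta> x y" "\<lambda>\<eta>. exchange \<eta> x y"])
    (use assms in \<open>auto intro: exchange_configs\<close>)

lemma sum_flip:
  assumes "x \<in> {1..N}"
  shows "(\<Sum>\<eta>\<in>configs N. F (flip \<eta> x)) = (\<Sum>\<eta>\<in>configs N. F \<eta>)"
  by (rule sum.reindex_bij_witness[of _ "\<lambda>\<eta>. flip \<eta> x" "\<lambda>\<eta>. flip \<eta> x"])
    (use assms in \<open>auto intro: flip_configs flip_flip\<close>)

lemma sum_configs_Suc:
  "(\<Sum>\<eta>\<in>configs (Suc N). F \<eta>) =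
    (\<Sum>\<eta>\<in>configs N. F (\<eta>(Suc N := 0)) + F (\<eta>(Suc N := 1)))" (is "?lhs = ?rhs")
proof -
  have "configs (Suc N) = (\<lambda>(i, \<eta>). \<eta>(Suc N := i)) ` ({0, 1} \<times> configs N)"
    by (simp add: configs_def atLeastAtMostSuc_conv PiE_insert_eq)
  moreover have "inj_on (\<lambda>(i, \<eta>). \<eta>(Suc N := i)) ({0::nat, 1} \<times> configs N)"
    using inj_combinator[of "Suc N" "{1..N}" "\<lambda>_. {0, 1::nat}"] by (simp add: configs_def)
  ultimately have "?lhs = (\<Sum>(i, \<eta>)\<in>{0, 1} \<times> configs N. F (\<eta>(Suc N := i)))"
    by (simp add: sum.reindex case_prod_unfold)
  also have "\<dots> = ?rhs"
    by (simp add: sum.cartesian_product[symmetric] sum.distrib)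
  finally show ?thesis .
qed

section \<open>The Poincare inequality\<close>

definition flip_energy :: "nat \<Rightarrow> (config \<Rightarrow> real) \<Rightarrow> nat \<Rightarrow> real" where
  "flip_energy N f x = (\<Sum>\<eta>\<in>configs N. (f (flip \<eta> x) - f \<eta>)\<^sup>2)"

definition bond_energy :: "nat \<Rightarrow> (config \<Rightarrow> real) \<Rightarrow> nat \<Rightarrow> real" where
  "bond_energy N f x = (\<Sum>\<eta>\<in>configs N. (f (exchange \<eta> x (x + 1)) - f \<eta>)\<^sup>2)"

lemma flip_energy_nonneg: "0 \<le> flip_energy N f x"
  by (simp add: flip_energy_def sum_nonneg)

lemma bond_energy_nonneg: "0 \<le> bond_energy N f x"
  by (simp add: bond_energy_def sum_nonneg)

text \<open>The flip energies control the variance of \<open>f\<close> on the hypercube with a constant independent of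
  the dimension. Clearing denominators makes the induction on \<open>N\<close> exact: conditioning on the last
  site splits \<open>f\<close> into \<open>f0\<close> and \<open>f1\<close>, the induction hypothesis handles \<open>f0 + f1\<close>, and the
  difference \<open>f1 - f0\<close> is precisely what the flip of the last site sees.\<close>

lemma hypercube_poincare:
  "2 ^ N * (\<Sum>\<eta>\<in>configs N. (f \<eta>)\<^sup>2) - (\<Sum>\<eta>\<in>configs N. f \<eta>)\<^sup>2 \<le>
    2 ^ N / 4 * (\<Sum>x = 1..N. flip_energy N f x)"
proof (induction N arbitrary: f)
  case 0
  have "configs 0 = {\<lambda>_. undefined}"
    by (simp add: configs_def)
  then show ?case by simp
next
  case (Suc N)
  define f0 where "f0 \<eta> = f (\<eta>(Suc N := 0))" for \<eta>
  define f1 where "f1 \<eta> = f (\<eta>(Suc N := 1))" for \<eta>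
  define g where "g \<eta> = f0 \<eta> + f1 \<eta>" for \<eta>
  let ?H = "\<Sum>\<eta>\<in>configs N. (f1 \<eta> - f0 \<eta>)\<^sup>2"
  have sum_f: "(\<Sum>\<eta>\<in>configs (Suc N). f \<eta>) = (\<Sum>\<eta>\<in>configs N. g \<eta>)"
    by (simp add: sum_configs_Suc g_def f0_def f1_def)
  have sum_squares: "2 * (\<Sum>\<eta>\<in>configs (Suc N). (f \<eta>)\<^sup>2) = (\<Sum>\<eta>\<in>configs N. (g \<eta>)\<^sup>2) + ?H"
    unfolding sum_configs_Suc sum_distrib_left sum.distrib[symmetric]
    by (intro sum.cong) (auto simp: g_def f0_def f1_def power2_eq_square algebra_simps)
  have last_flip: "flip_energy (Suc N) f (Suc N) = 2 * ?H"
    unfolding flip_energy_def sum_configs_Suc sum_distrib_left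
    by (intro sum.cong) (auto simp: f0_def f1_def flip_def power2_eq_square algebra_simps)
  have "flip_energy N g x \<le> 2 * flip_energy (Suc N) f x" if x: "x \<in> {1..N}" for x
  proof -
    have upd: "flip (\<eta>(Suc N := i)) x = (flip \<eta> x)(Suc N := i)" for \<eta> i
      using x by (auto simp: flip_def)
    have "(a + b - (c + d))\<^sup>2 \<le> 2 * ((a - c)\<^sup>2 + (b - d)\<^sup>2)" for a b c d :: real
      using zero_le_power2[of "(a - c) - (b - d)"] by (simp add: power2_eq_square algebra_simps)
    then show ?thesis
      unfolding flip_energy_def sum_configs_Suc sum_distrib_left upd
      by (intro sum_mono) (simp add: g_def f0_def f1_def)
  qed
  then have "(\<Sum>x = 1..N. flip_energy N g x) \<le> 2 * (\<Sum>x = 1..N. flip_energy (Suc N) f x)"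
    unfolding sum_distrib_left by (rule sum_mono)
  then have other_flips: "2 ^ N / 4 * (\<Sum>x = 1..N. flip_energy N g x) \<le>
      2 ^ N / 4 * (2 * (\<Sum>x = 1..N. flip_energy (Suc N) f x))"
    by (intro mult_left_mono) auto
  have "2 ^ Suc N * (\<Sum>\<eta>\<in>configs (Suc N). (f \<eta>)\<^sup>2) - (\<Sum>\<eta>\<in>configs (Suc N). f \<eta>)\<^sup>2 =
      2 ^ N * (2 * (\<Sum>\<eta>\<in>configs (Suc N). (f \<eta>)\<^sup>2)) - (\<Sum>\<eta>\<in>configs (Suc N). f \<eta>)\<^sup>2"
    by simp
  also have "\<dots> = 2 ^ N * (\<Sum>\<eta>\<in>configs N. (g \<eta>)\<^sup>2) - (\<Sum>\<eta>\<in>configs N. g \<eta>)\<^sup>2 + 2 ^ N * ?H"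
    unfolding sum_f sum_squares by (simp add: algebra_simps)
  also have "\<dots> \<le> 2 ^ N / 4 * (2 * (\<Sum>x = 1..N. flip_energy (Suc N) f x)) + 2 ^ N * ?H"
    using Suc.IH[of g] other_flips by linarith
  also have "\<dots> = 2 ^ Suc N / 4 * (\<Sum>x = 1..Suc N. flip_energy (Suc N) f x)"
    by (simp add: last_flip algebra_simps)
  finally show ?case .
qed

text \<open>One step of the path: carry the value of site \<open>x + 1\<close> to site \<open>x\<close>, flip there, carry it back.\<close>

lemma flip_via_exchange:
  "flip \<eta> (Suc x) = exchange (flip (exchange \<eta> x (x + 1)) x) x (x + 1)"
  by (auto simp: flip_def exchange_def)

text \<open>The weight \<open>k\<close> favours the middle term, which will be a flip reached by a path of length \<open>k\<close>:
  iterating with factors \<open>1 + 1/k\<close> gives linear growth in the length of the path, where equal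
  weights would give exponential growth.\<close>

lemma square_sum3_weighted:
  fixes k u v w :: real
  assumes "0 < k"
  shows "(u + v + w)\<^sup>2 \<le> (1 + 1 / k) * v\<^sup>2 + 2 * (1 + k) * (u\<^sup>2 + w\<^sup>2)"
proof -
  have "0 \<le> (v - k * (u + w))\<^sup>2 / k"
    using assms by simp
  then have "2 * v * (u + w) \<le> v\<^sup>2 / k + k * (u + w)\<^sup>2"
    using assms by (simp add: power2_eq_square field_simps)
  moreover have "(u + w)\<^sup>2 \<le> 2 * (u\<^sup>2 + w\<^sup>2)"
    using zero_le_power2[of "u - w"] by (simp add: power2_eq_square algebra_simps)
  then have "(1 + k) * (u + w)\<^sup>2 \<le> (1 + k) * (2 * (u\<^sup>2 + w\<^sup>2))"
    using assms by (intro mult_left_mono) auto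
  ultimately show ?thesis
    by (simp add: power2_eq_square algebra_simps)
qed

text \<open>Split the increment of \<open>f\<close> along \<open>flip_via_exchange\<close> into swap, flip, swap. Each intermediate
  configuration is a bijective image of \<open>\<eta>\<close>, so after summation over the uniform measure each
  piece is the energy of that move.\<close>

lemma flip_energy_Suc:
  assumes x: "1 \<le> x" "x < N"
  shows "flip_energy N f (Suc x) \<le>
    (1 + 1 / real x) * flip_energy N f x + 4 * (1 + real x) * bond_energy N f x"
proof -
  have x_in: "x \<in> {1..N}" "x + 1 \<in> {1..N}"
    using x by auto
  let ?\<sigma> = "\<lambda>\<eta>. exchange \<eta> x (x + 1)"
  let ?B = "\<lambda>\<eta>. (f (?\<sigma> \<eta>) - f \<eta>)\<^sup>2"
  let ?F = "\<lambda>\<eta>. (f (flip \<eta> x) - f \<eta>)\<^sup>2"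
  have "(f (flip \<eta> (Suc x)) - f \<eta>)\<^sup>2 \<le>
      (1 + 1 / real x) * ?F (?\<sigma> \<eta>) + 2 * (1 + real x) * (?B (flip (?\<sigma> \<eta>) x) + ?B \<eta>)" for \<eta>
    using square_sum3_weighted[of "real x" "f (?\<sigma> (flip (?\<sigma> \<eta>) x)) - f (flip (?\<sigma> \<eta>) x)"
      "f (flip (?\<sigma> \<eta>) x) - f (?\<sigma> \<eta>)" "f (?\<sigma> \<eta>) - f \<eta>"] x
    by (simp add: flip_via_exchange)
  then have "flip_energy N f (Suc x) \<le> (\<Sum>\<eta>\<in>configs N.
      (1 + 1 / real x) * ?F (?\<sigma> \<eta>) + 2 * (1 + real x) * (?B (flip (?\<sigma> \<eta>) x) + ?B \<eta>))"
    unfolding flip_energy_def by (rule sum_mono)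
  also have "\<dots> = (1 + 1 / real x) * (\<Sum>\<eta>\<in>configs N. ?F (?\<sigma> \<eta>)) +
      2 * (1 + real x) * ((\<Sum>\<eta>\<in>configs N. ?B (flip (?\<sigma> \<eta>) x)) + (\<Sum>\<eta>\<in>configs N. ?B \<eta>))"
    by (simp only: sum.distrib[symmetric] sum_distrib_left)
  also have "(\<Sum>\<eta>\<in>configs N. ?F (?\<sigma> \<eta>)) = flip_energy N f x"
    using sum_exchange[OF x_in, of ?F] by (simp add: flip_energy_def)
  also have "(\<Sum>\<eta>\<in>configs N. ?B (flip (?\<sigma> \<eta>) x)) = bond_energy N f x"
    using sum_exchange[OF x_in, of "\<lambda>\<eta>. ?B (flip \<eta> x)"] sum_flip[OF x_in(1), of ?B]
    by (simp add: bond_energy_def)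
  also have "(\<Sum>\<eta>\<in>configs N. ?B \<eta>) = bond_energy N f x"
    by (simp add: bond_energy_def)
  finally show ?thesis
    by (simp add: algebra_simps)
qed

text \<open>The energy of all moves used by the path that flips site \<open>x\<close> at the left end. The factor \<open>4\<close>
  is the square of the number \<open>2\<close> of passages through every bond.\<close>

definition path_energy :: "nat \<Rightarrow> (config \<Rightarrow> real) \<Rightarrow> nat \<Rightarrow> real" where
  "path_energy N f x = flip_energy N f 1 + 4 * (\<Sum>y = 1..<x. bond_energy N f y)"

text \<open>The telescoping form of \<open>flip_energy_Suc\<close>, with the product of the factors \<open>1 + 1/k\<close> over
  \<open>1 \<le> k < x\<close> equal to \<open>x\<close>.\<close>

lemma flip_energy_le:
  assumes "1 \<le> x" "x \<le> N"
  shows "flip_energy N f x \<le> real x * path_energy N f x"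
  using assms
proof (induction x rule: dec_induct)
  case base
  then show ?case by (simp add: path_energy_def)
next
  case (step x)
  let ?E = "path_energy N f x"
  have "flip_energy N f (Suc x) \<le>
      (1 + 1 / real x) * flip_energy N f x + 4 * (1 + real x) * bond_energy N f x"
    using step by (intro flip_energy_Suc) auto
  also have "\<dots> \<le> (1 + 1 / real x) * (real x * ?E) + 4 * (1 + real x) * bond_energy N f x"
    using step by (intro add_right_mono mult_left_mono) auto
  also have "\<dots> = real (Suc x) * (?E + 4 * bond_energy N f x)"
    using step by (simp add: field_simps)
  also have "?E + 4 * bond_energy N f x = path_energy N f (Suc x)"
    using step by (simp add: path_energy_def)
  finally show ?case .
qed

lemma bond_flip_poincare:
  assumes mean: "(\<Sum>\<eta>\<in>configs N. f \<eta>) = 0"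
  shows "(\<Sum>\<eta>\<in>configs N. (f \<eta>)\<^sup>2) \<le> (real N)\<^sup>2 / 4 * path_energy N f N"
proof -
  have "2 ^ N * (\<Sum>\<eta>\<in>configs N. (f \<eta>)\<^sup>2) \<le> 2 ^ N * (1 / 4 * (\<Sum>x = 1..N. flip_energy N f x))"
    using hypercube_poincare[of N f] mean by simp
  then have "(\<Sum>\<eta>\<in>configs N. (f \<eta>)\<^sup>2) \<le> 1 / 4 * (\<Sum>x = 1..N. flip_energy N f x)"
    by (rule mult_left_le_imp_le) simp
  also have "(\<Sum>x = 1..N. flip_energy N f x) \<le> (\<Sum>x = 1..N. real N * path_energy N f N)"
  proof (rule sum_mono)
    fix x assume x: "x \<in> {1..N}"
    have mono: "path_energy N f x \<le> path_energy N f N"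
      unfolding path_energy_def using x
      by (intro add_left_mono mult_left_mono sum_mono2) (auto simp: bond_energy_nonneg)
    have "0 \<le> path_energy N f x"
      by (simp add: path_energy_def flip_energy_nonneg bond_energy_nonneg sum_nonneg)
    then have "real x * path_energy N f x \<le> real N * path_energy N f N"
      using x mono by (intro mult_mono) auto
    then show "flip_energy N f x \<le> real N * path_energy N f N"
      using flip_energy_le[of x N f] x by simp
  qed
  finally show ?thesis
    by (simp add: power2_eq_square)
qed

section \<open>The exclusion process with open boundaries\<close>

text \<open>The rate at which the values at \<open>x\<close> and \<open>x + 1\<close> are swapped, in either direction. Grouping
  both jumps of a bond makes exchanges and boundary flips the only moves, all of them bijections
  of the configurations.\<close>

definition bond_rate :: "real \<Rightarrow> config \<Rightarrow> nat \<Rightarrow> real" where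
  "bond_rate p \<eta> x = p * real (\<eta> x) * (1 - real (\<eta> (x + 1))) + (1 - p) * real (\<eta> (x + 1)) * (1 - real (\<eta> x))"

definition boundary_rate :: "real \<Rightarrow> real \<Rightarrow> config \<Rightarrow> nat \<Rightarrow> real" where
  "boundary_rate r s \<eta> x = r * (1 - real (\<eta> x)) + s * real (\<eta> x)"

lemma sep_generator_rates:
  "sep_generator p \<alpha> \<beta> \<gamma> \<delta> N f \<eta> =
    (\<Sum>x = 1..<N. bond_rate p \<eta> x * (f (exchange \<eta> x (x + 1)) - f \<eta>))
    + boundary_rate \<alpha> \<gamma> \<eta> 1 * (f (flip \<eta> 1) - f \<eta>)
    + boundary_rate \<delta> \<beta> \<eta> N * (f (flip \<eta> N) - f \<eta>)"
proof -
  have "{1..N - 1} = {1..<N}"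
    by auto
  moreover have "(\<Sum>x = 2..N. (1 - p) * real (\<eta> x) * (1 - real (\<eta> (x - 1))) * (f (exchange \<eta> x (x - 1)) - f \<eta>)) =
      (\<Sum>x = 1..<N. (1 - p) * real (\<eta> (x + 1)) * (1 - real (\<eta> x)) * (f (exchange \<eta> x (x + 1)) - f \<eta>))"
    by (rule sum.reindex_bij_witness[of _ Suc "\<lambda>x. x - 1"]) (auto simp: exchange_commute)
  ultimately show ?thesis
    by (simp add: sep_generator_def bond_rate_def boundary_rate_def sum.distrib[symmetric] algebra_simps)
qed

lemma finite_generator_sep:
  assumes "N \<ge> 1"
  shows "finite_generator (configs N) (sep_generator p \<alpha> \<beta> \<gamma> \<delta> N)"
proof
  show "finite (configs N)" "configs N \<noteq> {}"
    by (rule finite_configs configs_nonempty)+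
next
  fix f g :: "config \<Rightarrow> real" and \<eta> :: config
  assume "\<And>\<xi>. \<xi> \<in> configs N \<Longrightarrow> f \<xi> = g \<xi>" and "\<eta> \<in> configs N"
  then show "sep_generator p \<alpha> \<beta> \<gamma> \<delta> N f \<eta> = sep_generator p \<alpha> \<beta> \<gamma> \<delta> N g \<eta>"
    unfolding sep_generator_rates using assms
    by (auto simp: exchange_configs flip_configs intro!: sum.cong arg_cong2[of _ _ _ _ "(+)"])
next
  fix f g :: "config \<Rightarrow> real" and \<eta> :: config
  show "sep_generator p \<alpha> \<beta> \<gamma> \<delta> N (\<lambda>\<xi>. f \<xi> + g \<xi>) \<eta> =
      sep_generator p \<alpha> \<beta> \<gamma> \<delta> N f \<eta> + sep_generator p \<alpha> \<beta> \<gamma> \<delta> N g \<eta>"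
    unfolding sep_generator_rates by (simp add: sum.distrib sum_subtractf algebra_simps)
next
  fix c :: real and f :: "config \<Rightarrow> real" and \<eta> :: config
  show "sep_generator p \<alpha> \<beta> \<gamma> \<delta> N (\<lambda>\<xi>. c * f \<xi>) \<eta> = c * sep_generator p \<alpha> \<beta> \<gamma> \<delta> N f \<eta>"
    unfolding sep_generator_rates by (simp add: sum_distrib_left algebra_simps)
next
  fix c :: real and \<eta> :: config
  show "sep_generator p \<alpha> \<beta> \<gamma> \<delta> N (\<lambda>_. c) \<eta> = 0"
    unfolding sep_generator_rates by simp
qed

text \<open>Substituting \<open>\<eta>\<close> by its exchange moves the exchange from \<open>f\<close> to the rate; the difference of the
  rate before and after is \<open>(2p - 1)(\<eta>(x+1) - \<eta>(x))\<close>. This is linear in \<open>\<eta>\<close>, a gradient, and so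
  the bonds will telescope.\<close>

lemma sum_bond_term:
  assumes "1 \<le> x" "x < N"
  shows "(\<Sum>\<eta>\<in>configs N. bond_rate p \<eta> x * (f (exchange \<eta> x (x + 1)) - f \<eta>)) =
    (2 * p - 1) * (\<Sum>\<eta>\<in>configs N. real (\<eta> (Suc x)) * f \<eta> - real (\<eta> x) * f \<eta>)"
proof -
  have x_in: "x \<in> {1..N}" "x + 1 \<in> {1..N}"
    using assms by auto
  let ?\<sigma> = "\<lambda>\<eta>. exchange \<eta> x (x + 1)"
  have "(\<Sum>\<eta>\<in>configs N. bond_rate p \<eta> x * f (?\<sigma> \<eta>)) =
      (\<Sum>\<eta>\<in>configs N. bond_rate p (?\<sigma> \<eta>) x * f \<eta>)"
    using sum_exchange[OF x_in, of "\<lambda>\<eta>. bond_rate p (?\<sigma> \<eta>) x * f \<eta>"] by simp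
  then have "(\<Sum>\<eta>\<in>configs N. bond_rate p \<eta> x * (f (?\<sigma> \<eta>) - f \<eta>)) =
      (\<Sum>\<eta>\<in>configs N. (bond_rate p (?\<sigma> \<eta>) x - bond_rate p \<eta> x) * f \<eta>)"
    by (simp add: right_diff_distrib left_diff_distrib sum_subtractf)
  also have "\<dots> = (2 * p - 1) * (\<Sum>\<eta>\<in>configs N. real (\<eta> (Suc x)) * f \<eta> - real (\<eta> x) * f \<eta>)"
    unfolding sum_distrib_left
    by (intro sum.cong) (auto simp: bond_rate_def exchange_def algebra_simps)
  finally show ?thesis .
qed

lemma sum_boundary_term:
  assumes x: "x \<in> {1..N}"
  shows "(\<Sum>\<eta>\<in>configs N. boundary_rate r s \<eta> x * (f (flip \<eta> x) - f \<eta>)) =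
    (r - s) * (\<Sum>\<eta>\<in>configs N. (2 * real (\<eta> x) - 1) * f \<eta>)"
proof -
  have "(\<Sum>\<eta>\<in>configs N. boundary_rate r s \<eta> x * f (flip \<eta> x)) =
      (\<Sum>\<eta>\<in>configs N. boundary_rate r s (flip \<eta> x) x * f \<eta>)"
    using sum_flip[OF x, of "\<lambda>\<eta>. boundary_rate r s (flip \<eta> x) x * f \<eta>"] x
    by (simp add: flip_flip cong: sum.cong)
  then have "(\<Sum>\<eta>\<in>configs N. boundary_rate r s \<eta> x * (f (flip \<eta> x) - f \<eta>)) =
      (\<Sum>\<eta>\<in>configs N. (boundary_rate r s (flip \<eta> x) x - boundary_rate r s \<eta> x) * f \<eta>)"
    by (simp add: right_diff_distrib left_diff_distrib sum_subtractf)
  also have "\<dots> = (r - s) * (\<Sum>\<eta>\<in>configs N. (2 * real (\<eta> x) - 1) * f \<eta>)"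
    unfolding sum_distrib_left
  proof (intro sum.cong refl)
    fix \<eta> assume "\<eta> \<in> configs N"
    from configs_value[OF this x]
    show "(boundary_rate r s (flip \<eta> x) x - boundary_rate r s \<eta> x) * f \<eta> =
        (r - s) * ((2 * real (\<eta> x) - 1) * f \<eta>)"
      by (auto simp: boundary_rate_def flip_def algebra_simps)
  qed
  finally show ?thesis .
qed

text \<open>The bonds telescope to \<open>(2p - 1)(\<eta>(N) - \<eta>(1))\<close>, and each end contributes its drift times
  \<open>2 \<eta> - 1\<close> with opposite signs at the two ends; the conditions on the drifts are exactly what
  cancels everything.\<close>

lemma sum_sep_generator:
  assumes N: "N \<ge> 1" and left: "\<alpha> - \<gamma> = p - 1 / 2" and right: "\<beta> - \<delta> = p - 1 / 2"
  shows "(\<Sum>\<eta>\<in>configs N. sep_generator p \<alpha> \<beta> \<gamma> \<delta> N f \<eta>) = 0"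
proof -
  define M where "M x = (\<Sum>\<eta>\<in>configs N. real (\<eta> x) * f \<eta>)" for x
  define T where "T = (\<Sum>\<eta>\<in>configs N. f \<eta>)"
  have bonds: "(\<Sum>\<eta>\<in>configs N. \<Sum>x = 1..<N. bond_rate p \<eta> x * (f (exchange \<eta> x (x + 1)) - f \<eta>)) =
      (2 * p - 1) * (M N - M 1)"
  proof -
    have "(\<Sum>\<eta>\<in>configs N. \<Sum>x = 1..<N. bond_rate p \<eta> x * (f (exchange \<eta> x (x + 1)) - f \<eta>)) =
        (\<Sum>x = 1..<N. (2 * p - 1) * (M (Suc x) - M x))"
      unfolding sum.swap[of _ "{1..<N}"] M_def sum_subtractf[symmetric]
      by (intro sum.cong sum_bond_term) auto
    also have "\<dots> = (2 * p - 1) * (M N - M 1)"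
      using N by (simp only: sum_distrib_left[symmetric] sum_Suc_diff')
    finally show ?thesis .
  qed
  have boundary: "(\<Sum>\<eta>\<in>configs N. boundary_rate r s \<eta> x * (f (flip \<eta> x) - f \<eta>)) =
      (r - s) * (2 * M x - T)" if "x \<in> {1..N}" for r s x
    unfolding sum_boundary_term[OF that] M_def T_def
    by (simp add: sum_distrib_left sum_subtractf algebra_simps)
  have "(\<Sum>\<eta>\<in>configs N. sep_generator p \<alpha> \<beta> \<gamma> \<delta> N f \<eta>) =
      (2 * p - 1) * (M N - M 1) + (\<alpha> - \<gamma>) * (2 * M 1 - T) - (\<beta> - \<delta>) * (2 * M N - T)"
    unfolding sep_generator_rates sum.distrib bonds using N
    by (subst (1 2) boundary) (auto simp: algebra_simps)
  also have "\<dots> = 0"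
    unfolding left right by (simp add: algebra_simps)
  finally show ?thesis .
qed

text \<open>The squared increment is invariant under the exchange, so its rate may be averaged with the rate
  of the reverse move. On configurations that the exchange changes, these two rates are \<open>p\<close> and
  \<open>1 - p\<close>, with mean \<open>1/2\<close> whatever \<open>p\<close> is.\<close>

lemma bond_dissipation:
  assumes "1 \<le> x" "x < N"
  shows "(\<Sum>\<eta>\<in>configs N. bond_rate p \<eta> x * (f (exchange \<eta> x (x + 1)) - f \<eta>)\<^sup>2) = bond_energy N f x / 2"
proof -
  have x_in: "x \<in> {1..N}" "x + 1 \<in> {1..N}"
    using assms by auto
  let ?\<sigma> = "\<lambda>\<eta>. exchange \<eta> x (x + 1)"
  let ?B = "\<lambda>\<eta>. (f (?\<sigma> \<eta>) - f \<eta>)\<^sup>2"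
  have "(\<Sum>\<eta>\<in>configs N. bond_rate p \<eta> x * ?B \<eta>) = (\<Sum>\<eta>\<in>configs N. bond_rate p (?\<sigma> \<eta>) x * ?B \<eta>)"
    using sum_exchange[OF x_in, of "\<lambda>\<eta>. bond_rate p (?\<sigma> \<eta>) x * ?B \<eta>"]
    by (simp add: power2_commute)
  then have "2 * (\<Sum>\<eta>\<in>configs N. bond_rate p \<eta> x * ?B \<eta>) =
      (\<Sum>\<eta>\<in>configs N. (bond_rate p \<eta> x + bond_rate p (?\<sigma> \<eta>) x) * ?B \<eta>)"
    by (simp add: distrib_right sum.distrib)
  also have "\<dots> = bond_energy N f x"
    unfolding bond_energy_def
  proof (intro sum.cong refl)
    fix \<eta> assume \<eta>: "\<eta> \<in> configs N"
    show "(bond_rate p \<eta> x + bond_rate p (?\<sigma> \<eta>) x) * ?B \<eta> = ?B \<eta>"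
    proof (cases "\<eta> x = \<eta> (x + 1)")
      case True
      then show ?thesis by (simp add: exchange_trivial)
    next
      case False
      then have "bond_rate p \<eta> x + bond_rate p (?\<sigma> \<eta>) x = 1"
        using configs_value[OF \<eta> x_in(1)] configs_value[OF \<eta> x_in(2)]
        by (auto simp: bond_rate_def exchange_def)
      then show ?thesis by simp
    qed
  qed
  finally show ?thesis by simp
qed

lemma boundary_dissipation:
  assumes x: "x \<in> {1..N}"
  shows "(\<Sum>\<eta>\<in>configs N. boundary_rate r s \<eta> x * (f (flip \<eta> x) - f \<eta>)\<^sup>2) =
    (r + s) / 2 * flip_energy N f x"
proof -
  let ?F = "\<lambda>\<eta>. (f (flip \<eta> x) - f \<eta>)\<^sup>2"
  have "(\<Sum>\<eta>\<in>configs N. boundary_rate r s \<eta> x * ?F \<eta>) =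
      (\<Sum>\<eta>\<in>configs N. boundary_rate r s (flip \<eta> x) x * ?F \<eta>)"
    using sum_flip[OF x, of "\<lambda>\<eta>. boundary_rate r s (flip \<eta> x) x * ?F \<eta>"] x
    by (simp add: flip_flip power2_commute cong: sum.cong)
  then have "2 * (\<Sum>\<eta>\<in>configs N. boundary_rate r s \<eta> x * ?F \<eta>) =
      (\<Sum>\<eta>\<in>configs N. (boundary_rate r s \<eta> x + boundary_rate r s (flip \<eta> x) x) * ?F \<eta>)"
    by (simp add: distrib_right sum.distrib)
  also have "\<dots> = (\<Sum>\<eta>\<in>configs N. (r + s) * ?F \<eta>)"
  proof (intro sum.cong refl)
    fix \<eta> assume "\<eta> \<in> configs N"
    from configs_value[OF this x]
    show "(boundary_rate r s \<eta> x + boundary_rate r s (flip \<eta> x) x) * ?F \<eta> = (r + s) * ?F \<eta>"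
      by (auto simp: boundary_rate_def flip_def)
  qed
  finally show ?thesis
    by (simp add: flip_energy_def sum_distrib_left[symmetric])
qed

text \<open>From \<open>2a(b - a) = (b\<^sup>2 - a\<^sup>2) - (b - a)\<^sup>2\<close>, applied to every jump,
  \<open>2 f L f = L(f\<^sup>2) - \<Gamma>(f)\<close> with \<open>\<Gamma>\<close> the rate-weighted sum of squared increments (the carre du
  champ). The term \<open>L(f\<^sup>2)\<close> sums to \<open>0\<close> by stationarity, and this replaces reversibility.\<close>

lemma sep_dissipation:
  assumes N: "N \<ge> 1" and left: "\<alpha> - \<gamma> = p - 1 / 2" and right: "\<beta> - \<delta> = p - 1 / 2"
  shows "- (\<Sum>\<eta>\<in>configs N. f \<eta> * sep_generator p \<alpha> \<beta> \<gamma> \<delta> N f \<eta>) =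
    (\<Sum>x = 1..<N. bond_energy N f x) / 4 +
    (\<alpha> + \<gamma>) / 4 * flip_energy N f 1 + (\<beta> + \<delta>) / 4 * flip_energy N f N"
proof -
  let ?L = "sep_generator p \<alpha> \<beta> \<gamma> \<delta> N"
  define \<Gamma> where "\<Gamma> \<eta> =
    (\<Sum>x = 1..<N. bond_rate p \<eta> x * (f (exchange \<eta> x (x + 1)) - f \<eta>)\<^sup>2)
    + boundary_rate \<alpha> \<gamma> \<eta> 1 * (f (flip \<eta> 1) - f \<eta>)\<^sup>2
    + boundary_rate \<delta> \<beta> \<eta> N * (f (flip \<eta> N) - f \<eta>)\<^sup>2" for \<eta>
  have jump: "2 * (a * (r * (b - a))) = r * (b\<^sup>2 - a\<^sup>2) - r * (b - a)\<^sup>2" for a b r :: real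
    by (simp add: power2_eq_square algebra_simps)
  have "2 * (f \<eta> * ?L f \<eta>) = ?L (\<lambda>\<xi>. (f \<xi>)\<^sup>2) \<eta> - \<Gamma> \<eta>" for \<eta>
    unfolding sep_generator_rates \<Gamma>_def distrib_left sum_distrib_left jump
    by (simp add: sum_subtractf)
  then have "2 * (\<Sum>\<eta>\<in>configs N. f \<eta> * ?L f \<eta>) = - (\<Sum>\<eta>\<in>configs N. \<Gamma> \<eta>)"
    using sum_sep_generator[OF assms] by (simp add: sum_distrib_left sum_subtractf)
  also have "(\<Sum>\<eta>\<in>configs N. \<Gamma> \<eta>) =
      (\<Sum>x = 1..<N. bond_energy N f x / 2) +
      (\<alpha> + \<gamma>) / 2 * flip_energy N f 1 + (\<beta> + \<delta>) / 2 * flip_energy N f N"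
    unfolding \<Gamma>_def sum.distrib sum.swap[of _ "{1..<N}"] using N
    by (intro arg_cong2[of _ _ _ _ "(+)"] sum.cong bond_dissipation)
      (auto simp: boundary_dissipation add.commute simp del: One_nat_def)
  finally show ?thesis
    by (simp add: sum_divide_distrib[symmetric] field_simps)
qed

text \<open>The dissipation contains the bond energies and the flip energy of site \<open>1\<close>, which are the moves
  on the paths in \<open>bond_flip_poincare\<close>; the energy of the right end is nonnegative. The minimum
  adjusts to whichever of the two kinds of move is slower.\<close>

lemma uniform_gap_sep:
  assumes N: "N \<ge> 1" and left: "\<alpha> - \<gamma> = p - 1 / 2" and right: "\<beta> - \<delta> = p - 1 / 2"
    and nonneg: "0 \<le> \<alpha> + \<gamma>" "0 \<le> \<beta> + \<delta>"
  shows "uniform_gap (configs N) (sep_generator p \<alpha> \<beta> \<gamma> \<delta> N) (min (1 / 4) (\<alpha> + \<gamma>) / (real N)\<^sup>2)"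
proof -
  interpret finite_generator "configs N" "sep_generator p \<alpha> \<beta> \<gamma> \<delta> N"
    by (rule finite_generator_sep[OF N])
  let ?c = "min (1 / 4) (\<alpha> + \<gamma>)"
  show ?thesis
  proof
    show "(\<Sum>\<eta>\<in>configs N. sep_generator p \<alpha> \<beta> \<gamma> \<delta> N f \<eta>) = 0" for f
      by (rule sum_sep_generator[OF N left right])
  next
    fix f :: "config \<Rightarrow> real"
    assume mean: "(\<Sum>\<eta>\<in>configs N. f \<eta>) = 0"
    have bonds: "0 \<le> (\<Sum>x = 1..<N. bond_energy N f x)"
      by (simp add: sum_nonneg bond_energy_nonneg)
    have "?c / (real N)\<^sup>2 * (\<Sum>\<eta>\<in>configs N. (f \<eta>)\<^sup>2) \<le>
        ?c / (real N)\<^sup>2 * ((real N)\<^sup>2 / 4 * path_energy N f N)"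
      using nonneg by (intro mult_left_mono bond_flip_poincare[OF mean]) auto
    also have "\<dots> = ?c / 4 * flip_energy N f 1 + ?c * (\<Sum>x = 1..<N. bond_energy N f x)"
      using N by (simp add: path_energy_def field_simps)
    also have "\<dots> \<le> (\<alpha> + \<gamma>) / 4 * flip_energy N f 1 + 1 / 4 * (\<Sum>x = 1..<N. bond_energy N f x)"
      using bonds by (intro add_mono mult_right_mono divide_right_mono flip_energy_nonneg min.cobounded1 min.cobounded2) auto
    also have "\<dots> \<le> - (\<Sum>\<eta>\<in>configs N. f \<eta> * sep_generator p \<alpha> \<beta> \<gamma> \<delta> N f \<eta>)"
      unfolding sep_dissipation[OF N left right] using nonneg by (simp add: flip_energy_nonneg)
    finally show "?c / (real N)\<^sup>2 * (\<Sum>\<eta>\<in>configs N. (f \<eta>)\<^sup>2) \<le>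
        - (\<Sum>\<eta>\<in>configs N. f \<eta> * sep_generator p \<alpha> \<beta> \<gamma> \<delta> N f \<eta>)" .
  qed
qed

section \<open>The mixing time\<close>

text \<open>Here \<open>q = 2p - 1\<close> is the drift in the bulk, and \<open>r\<close>, \<open>s\<close> are the rates of the two jumps at one
  end. Once the root is isolated and squared, the quadratic terms in \<open>q - r + s\<close> cancel.\<close>

lemma boundary_parameter_eq_1:
  fixes r s q :: real
  assumes "0 < r" and "0 \<le> s" and "1 / (2 * r) * (q - r + s + sqrt ((q - r + s)\<^sup>2 + 4 * r * s)) = 1"
  shows "r - s = q / 2"
proof -
  have sqrt_eq: "sqrt ((q - r + s)\<^sup>2 + 4 * r * s) = 2 * r - (q - r + s)"
    using assms by (simp add: field_simps)
  have "0 \<le> (q - r + s)\<^sup>2 + 4 * r * s"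
    using assms by simp
  then have "(q - r + s)\<^sup>2 + 4 * r * s = (2 * r - (q - r + s))\<^sup>2"
    using sqrt_eq by (metis real_sqrt_pow2)
  then have "4 * r * (2 * r - 2 * s - q) = 0"
    by (simp add: power2_eq_square algebra_simps)
  then show ?thesis
    using assms(1) by simp
qed

theorem theorem1p6:
  fixes p \<alpha> \<beta> \<gamma> \<delta> a b :: real
  assumes "1 / 2 < p" and "p \<le> 1"
    and "\<alpha> > 0" and "\<beta> > 0" and "\<gamma> \<ge> 0" and "\<delta> \<ge> 0"
    and "\<And>N. N \<ge> 1 \<Longrightarrow> \<exists>!\<mu>. stationary (configs N) (sep_generator p \<alpha> \<beta> \<gamma> \<delta> N) \<mu>"
    and "a = 1 / (2 * \<alpha>) * (2 * p - 1 - \<alpha> + \<gamma> + sqrt ((2 * p - 1 - \<alpha> + \<gamma>)\<^sup>2 + 4 * \<alpha> * \<gamma>))"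
    and "b = 1 / (2 * \<beta>) * (2 * p - 1 - \<beta> + \<delta> + sqrt ((2 * p - 1 - \<beta> + \<delta>)\<^sup>2 + 4 * \<beta> * \<delta>))"
    and "a = 1" and "b = 1"
  shows "\<exists>C::real. \<forall>\<epsilon>\<in>{0<..<1}. \<forall>\<^sub>F N in sequentially.
           sep_mixing_time p \<alpha> \<beta> \<gamma> \<delta> N \<epsilon> \<le> ereal (C * real N ^ 3)"
proof -
  have left: "\<alpha> - \<gamma> = p - 1 / 2"
    using boundary_parameter_eq_1[of \<alpha> \<gamma> "2 * p - 1"] assms by simp
  have right: "\<beta> - \<delta> = p - 1 / 2"
    using boundary_parameter_eq_1[of \<beta> \<delta> "2 * p - 1"] assms by simp
  define c where "c = min (1 / 4) (\<alpha> + \<gamma>)"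
  have c: "0 < c"
    using assms by (simp add: c_def)
  have "\<forall>\<^sub>F N in sequentially. sep_mixing_time p \<alpha> \<beta> \<gamma> \<delta> N \<epsilon> \<le> ereal (1 / c * real N ^ 3)"
    if \<epsilon>: "0 < \<epsilon>" for \<epsilon>
  proof -
    \<comment> \<open>Relaxation beats the size \<open>2\<^sup>N\<close> of the state space: \<open>exp (- N) sqrt (2\<^sup>N)\<close> vanishes.\<close>
    have "sqrt 2 < exp 1"
      using exp_ge_add_one_self[of 1] sqrt2_less_2 by linarith
    then have "(\<lambda>N. (sqrt 2 / exp 1) ^ N) \<longlonglongrightarrow> 0"
      by (intro LIMSEQ_power_zero) simp
    then have "\<forall>\<^sub>F N in sequentially. (sqrt 2 / exp 1) ^ N < \<epsilon>"
      using \<epsilon> by (rule order_tendstoD)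
    then show ?thesis
      using eventually_ge_at_top[of 1]
    proof eventually_elim
      case (elim N)
      interpret uniform_gap "configs N" "sep_generator p \<alpha> \<beta> \<gamma> \<delta> N" "c / (real N)\<^sup>2"
        unfolding c_def using elim assms by (intro uniform_gap_sep left right) auto
      have "- (c / (real N)\<^sup>2) * (1 / c * real N ^ 3) = - real N"
        using c elim by (simp add: power2_eq_square power3_eq_cube)
      then have "1 / 2 * (exp (- (c / (real N)\<^sup>2) * (1 / c * real N ^ 3)) * sqrt (card (configs N))) =
          1 / 2 * (sqrt 2 / exp 1) ^ N"
        by (simp add: card_configs real_sqrt_power power_divide exp_minus field_simps
            exp_of_nat_mult[symmetric])
      also have "\<dots> < \<epsilon>"
        using elim \<epsilon> by simp
      finally show ?case
        unfolding sep_mixing_time_def using assms(7)[of N] elim c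
        by (intro mixing_time_le) auto
    qed
  qed
  then show ?thesis
    by (intro exI[of _ "1 / c"]) auto
qed

end
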